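(* $\max\{T_3(1):f\in\mathcal{T}\}=8$ and $\min\{T_3(1):f\in\mathcal{T}\}=-8$, where for $f\in\mathcal{T}$, $f(z)=z+\sum_{n=2}^\infty a_nz^n$, one sets $T_3(1)=\det\begin{pmatrix} 1 & a_2 & a_3 \\ a_2 & 1 & a_2 \\ a_3 & a_2 & 1 \end{pmatrix}$.
   Context: $\mathbb{D}=\{z\in\mathbb{C}:|z|<1\}$. $\mathcal{T}$ is the class of typically real functions: analytic functions $f$ in $\mathbb{D}$, normalized by $f(z)=z+\sum_{n=2}^\infty a_nz^n$, with $(\operatorname{Im} z)(\operatorname{Im} f(z))\ge0$ for $z\in\mathbb{D}$. By a theorem of Robertson, $f\in\mathcal{T}$ if and only if $f(z)=\int_{-1}^1\frac{z}{1-2tz+z^2}\,d\mu(t)$ for some probability measure $\mu$ on $[-1,1]$. In particular all coefficients $a_n$ are real. *)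

theory Defs
  imports "HOL-Complex_Analysis.Complex_Analysis"
begin

definition typically_real :: "(complex \<Rightarrow> complex) set" where
  "typically_real = {f. f holomorphic_on ball 0 1 \<and> f 0 = 0 \<and> deriv f 0 = 1 \<and>
     (\<forall>z\<in>ball 0 1. Im z * Im (f z) \<ge> 0)}"

text \<open>The Taylor coefficients of a typically real function are real (see
  \<open>typically_real_coeff\<close> below), so taking the real part only changes the type;
  it lets the determinant below be compared with real numbers.\<close>

definition tcoeff :: "(complex \<Rightarrow> complex) \<Rightarrow> nat \<Rightarrow> real" where
  "tcoeff f n = Re ((deriv ^^ n) f 0 / fact n)"

definition T31 :: "(complex \<Rightarrow> complex) \<Rightarrow> real" where
  "T31 f = (let a2 = tcoeff f 2; a3 = tcoeff f 3 in
     det (vector [vector [1, a2, a3],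
                  vector [a2, 1, a2],
                  vector [a3, a2, 1]] :: real^3^3))"

lemma deriv_real_on_reals:
  fixes h :: "complex \<Rightarrow> complex"
  assumes h: "h holomorphic_on ball 0 1"
    and re: "\<And>x::real. \<bar>x\<bar> < 1 \<Longrightarrow> Im (h (of_real x)) = 0"
    and x: "\<bar>x::real\<bar> < 1"
  shows "Im (deriv h (of_real x)) = 0"
proof -
  have "(h has_field_derivative deriv h (of_real x)) (at (of_real x))"
    using h x by (intro holomorphic_derivI[of h "ball 0 1"]) auto
  then have "((\<lambda>t. h (of_real t)) has_vector_derivative deriv h (of_real x)) (at x)"
    by (rule has_vector_derivative_real_field)
  then have "((\<lambda>t. Im (h (of_real t))) has_vector_derivative Im (deriv h (of_real x))) (at x)"
    by (rule bounded_linear.has_vector_derivative[OF bounded_linear_Im])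
  then have 1: "((\<lambda>t. Im (h (of_real t))) has_real_derivative Im (deriv h (of_real x))) (at x)"
    by (simp add: has_real_derivative_iff_has_vector_derivative)
  have 2: "((\<lambda>t. Im (h (of_real t))) has_real_derivative 0) (at x)"
  proof (rule has_field_derivative_transform_within_open)
    show "((\<lambda>t. 0) has_real_derivative 0) (at x)" by simp
    show "open {-1<..<1::real}" by simp
    show "x \<in> {-1<..<1::real}" using x by auto
    show "0 = Im (h (of_real t))" if "t \<in> {-1<..<1}" for t
      using re[of t] that by auto
  qed
  show ?thesis using DERIV_unique[OF 1 2] .
qed

lemma typically_real_Im_0:
  assumes f: "f \<in> typically_real" and x: "\<bar>x::real\<bar> < 1"
  shows "Im (f (of_real x)) = 0"
proof -
  have hol: "f holomorphic_on ball 0 1" and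
    pos: "\<And>z. z \<in> ball 0 1 \<Longrightarrow> Im z * Im (f z) \<ge> 0"
    using f by (auto simp: typically_real_def)
  have cont: "isCont f (of_real x)"
    using hol x continuous_on_interior[OF holomorphic_on_imp_continuous_on[OF hol]] by simp
  have lim: "((\<lambda>t. Im (f (Complex x t))) \<longlongrightarrow> Im (f (of_real x))) (at 0)"
  proof -
    have "((\<lambda>t. Complex x t) \<longlongrightarrow> Complex x 0) (at 0)"
      by (intro tendsto_Complex tendsto_intros)
    then have "((\<lambda>t. f (Complex x t)) \<longlongrightarrow> f (of_real x)) (at 0)"
      using isCont_tendsto_compose[OF cont] by (simp add: complex_of_real_def)
    then show ?thesis by (rule tendsto_Im)
  qed
  have ev: "\<forall>\<^sub>F t in at 0. Complex x t \<in> ball 0 1"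
  proof -
    have "((\<lambda>t. Complex x t) \<longlongrightarrow> Complex x 0) (at 0)"
      by (intro tendsto_Complex tendsto_intros)
    moreover have "Complex x 0 \<in> ball 0 1" using x by (simp add: complex_norm)
    ultimately show ?thesis using topological_tendstoD[OF _ open_ball] by blast
  qed
  have "Im (f (of_real x)) \<ge> 0"
  proof (rule tendsto_lowerbound)
    show "((\<lambda>t. Im (f (Complex x t))) \<longlongrightarrow> Im (f (of_real x))) (at_right 0)"
      using lim by (simp add: filterlim_at_split)
    have "\<forall>\<^sub>F t in at_right 0. Complex x t \<in> ball 0 1"
      using ev by (simp add: eventually_at_split)
    moreover have "\<forall>\<^sub>F t::real in at_right 0. t > 0" by (simp add: eventually_at_right_less)
    ultimately show "\<forall>\<^sub>F t in at_right 0. 0 \<le> Im (f (Complex x t))"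
    proof eventually_elim
      case (elim t) then show ?case using pos[of "Complex x t"] by (simp add: zero_le_mult_iff)
    qed
  qed simp
  moreover have "Im (f (of_real x)) \<le> 0"
  proof (rule tendsto_upperbound)
    show "((\<lambda>t. Im (f (Complex x t))) \<longlongrightarrow> Im (f (of_real x))) (at_left 0)"
      using lim by (simp add: filterlim_at_split)
    have "\<forall>\<^sub>F t in at_left 0. Complex x t \<in> ball 0 1"
      using ev by (simp add: eventually_at_split)
    moreover have "\<forall>\<^sub>F t::real in at_left 0. t < 0"
      by (auto simp: eventually_at_filter)
    ultimately show "\<forall>\<^sub>F t in at_left 0. Im (f (Complex x t)) \<le> 0"
    proof eventually_elim
      case (elim t) then show ?case using pos[of "Complex x t"] by (simp add: zero_le_mult_iff)
    qed
  qed simp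
  ultimately show ?thesis by simp
qed

lemma typically_real_coeff:
  assumes f: "f \<in> typically_real"
  shows "complex_of_real (tcoeff f n) = (deriv ^^ n) f 0 / fact n"
proof -
  have hol: "f holomorphic_on ball 0 1" using f by (auto simp: typically_real_def)
  have "\<bar>x::real\<bar> < 1 \<Longrightarrow> Im ((deriv ^^ n) f (of_real x)) = 0" for x
  proof (induction n arbitrary: x)
    case 0 then show ?case using typically_real_Im_0[OF f] by simp
  next
    case (Suc n)
    then show ?case
      using deriv_real_on_reals[of "(deriv ^^ n) f" x] holomorphic_higher_deriv[OF hol]
      by simp
  qed
  from this[of 0] have "Im ((deriv ^^ n) f 0) = 0" by simp
  then have "(deriv ^^ n) f 0 = of_real (Re ((deriv ^^ n) f 0))"
    by (simp add: complex_eq_iff)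
  then have "(deriv ^^ n) f 0 / fact n = of_real (Re ((deriv ^^ n) f 0) / fact n)"
    by simp
  then show ?thesis unfolding tcoeff_def by (metis Re_complex_of_real)
qed

lemma typically_real_expansion:
  assumes f: "f \<in> typically_real" and z: "z \<in> ball 0 1"
  shows "(\<lambda>n. complex_of_real (tcoeff f n) * z ^ n) sums f z"
    and "tcoeff f 0 = 0" and "tcoeff f 1 = 1"
proof -
  have hol: "f holomorphic_on ball 0 1" using f by (auto simp: typically_real_def)
  show "(\<lambda>n. complex_of_real (tcoeff f n) * z ^ n) sums f z"
    using holomorphic_power_series[OF hol z] by (simp add: typically_real_coeff[OF f])
  show "tcoeff f 0 = 0" "tcoeff f 1 = 1"
    using f by (auto simp: tcoeff_def typically_real_def)
qed

end

theory Submission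
  imports Defs
begin

text \<open>
  The determinant factors as \<open>(1 - a\<^sub>3) (1 + a\<^sub>3 - 2 a\<^sub>2\<^sup>2)\<close>, so the bounds follow from
  \<open>a\<^sub>2\<^sup>2 \<le> 1 + a\<^sub>3\<close> and \<open>a\<^sub>3 \<le> 3\<close>. Neither inequality needs Robertson's representation:
  on a circle of radius \<open>r < 1\<close> the functions \<open>Im f\<close> and \<open>sin \<theta>\<close> have the same sign, so the
  integrals of \<open>Im f\<close> against \<open>sin \<theta> (x + y cos \<theta>)\<^sup>2\<close> and against \<open>sin\<^sup>3 \<theta>\<close> are nonnegative.
  Orthogonality expresses them through \<open>a\<^sub>2\<close> and \<open>a\<^sub>3\<close>, and \<open>r\<close> tends to 1.
  The extremal functions are the Koebe function and its odd part.
\<close>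

section \<open>Fourier coefficients of \<open>f\<close> on a circle of radius
  \<open>r\<close>\<close>

lemma circlepath_0_conv_cis:
  "circlepath 0 r t = of_real r * cis (2*pi*t)"
  "vector_derivative (circlepath 0 r) (at t) = 2*pi*\<i> * (of_real r * cis (2*pi*t))"
  by (simp add: circlepath cis_conv_exp mult_ac, simp add: vector_derivative_circlepath cis_conv_exp mult_ac)

text \<open>This is Cauchy's formula for the n-th derivative, parametrized by z = r cis(2 pi t) and
  scaled by r^n / (2 pi i). The factor z in dz = 2 pi i z dt cancels one power of the denominator
  z^(n+1).\<close>

lemma holomorphic_circle_integral_cis_neg:
  assumes f: "f holomorphic_on ball 0 1" and r: "0 < r" "r < 1"
  shows "((\<lambda>t. f (of_real r * cis (2*pi*t)) * cis (- (real n * (2*pi*t)))) has_integral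
           of_real r ^ n * ((deriv ^^ n) f 0 / fact n)) {0..1}"
proof -
  have "continuous_on (cball 0 r) f" "f holomorphic_on ball 0 r"
    using r by (auto intro!: holomorphic_on_imp_continuous_on holomorphic_on_subset[OF f])
  then have "((\<lambda>u. f u / (u-0) ^ Suc n) has_contour_integral
      ((2 * pi * \<i>) / fact n * (deriv ^^ n) f 0)) (circlepath 0 r)"
    by (rule Cauchy_has_contour_integral_higher_derivative_circlepath) (use r in auto)
  then have I: "((\<lambda>t. of_real r ^ n / (2*pi*\<i>) * (f (circlepath 0 r t) / circlepath 0 r t ^ Suc n *
        vector_derivative (circlepath 0 r) (at t))) has_integral
      of_real r ^ n / (2*pi*\<i>) * ((2 * pi * \<i>) / fact n * (deriv ^^ n) f 0)) {0..1}"
    unfolding has_contour_integral by (intro has_integral_mult_right) simp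
  have eq: "of_real r ^ n / (2*pi*\<i>) * (f (circlepath 0 r t) / circlepath 0 r t ^ Suc n *
        vector_derivative (circlepath 0 r) (at t)) =
      f (of_real r * cis (2*pi*t)) * cis (- (real n * (2*pi*t)))" for t
  proof -
    have cis: "cis (- (real n * (2*pi*t))) = inverse (cis (2*pi*t) ^ n)"
      by (simp only: Complex.DeMoivre cis_inverse)
    show ?thesis unfolding circlepath_0_conv_cis cis using r
      by (simp add: power_mult_distrib field_simps)
  qed
  have "of_real r ^ n / (2*pi*\<i>) * ((2 * pi * \<i>) / fact n * (deriv ^^ n) f 0) =
      of_real r ^ n * ((deriv ^^ n) f 0 / fact n)"
    by (simp add: field_simps)
  then show ?thesis using I unfolding eq by (simp only:)
qed

text \<open>Cauchy's theorem applies to f(z) z^(n-1), as dz supplies the remaining factor z; this is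
  where \<open>n > 0\<close> enters.\<close>

lemma holomorphic_circle_integral_cis_pos:
  assumes f: "f holomorphic_on ball 0 1" and r: "0 < r" "r < 1" and n: "n > 0"
  shows "((\<lambda>t. f (of_real r * cis (2*pi*t)) * cis (real n * (2*pi*t))) has_integral 0) {0..1}"
proof -
  obtain m where m: "n = Suc m" using n by (cases n) auto
  have "((\<lambda>u. f u * u ^ m) has_contour_integral 0) (circlepath 0 r)"
    by (rule Cauchy_theorem_disc_simple[of _ 0 1]) (use r in \<open>auto intro!: holomorphic_intros f\<close>)
  then have I: "((\<lambda>t. 1 / (of_real r ^ n * (2*pi*\<i>)) * (f (circlepath 0 r t) * circlepath 0 r t ^ m *
        vector_derivative (circlepath 0 r) (at t))) has_integral
      1 / (of_real r ^ n * (2*pi*\<i>)) * 0) {0..1}"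
    unfolding has_contour_integral by (intro has_integral_mult_right) simp
  have eq: "1 / (of_real r ^ n * (2*pi*\<i>)) * (f (circlepath 0 r t) * circlepath 0 r t ^ m *
        vector_derivative (circlepath 0 r) (at t)) =
      f (of_real r * cis (2*pi*t)) * cis (real n * (2*pi*t))" for t
  proof -
    have cis: "cis (real n * (2*pi*t)) = cis (2*pi*t) ^ n"
      by (simp only: Complex.DeMoivre)
    show ?thesis unfolding circlepath_0_conv_cis cis using r
      by (simp add: m power_mult_distrib divide_simps)
  qed
  show ?thesis using I unfolding eq by simp
qed

text \<open>Subtracting the two preceding integrals leaves the kernel cis(n theta) - cis(-n theta) =
  2 i sin(n theta), and Re (2 i w) = -2 Im w turns the real part into a sine integral of Im
  f.\<close>

lemma typically_real_sine_coefficient: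
  assumes f: "f \<in> typically_real" and r: "0 < r" "r < 1" and n: "n > 0"
  shows "((\<lambda>t. Im (f (of_real r * cis (2*pi*t))) * sin (real n * (2*pi*t))) has_integral
           r ^ n * tcoeff f n / 2) {0..1}"
proof -
  have hol: "f holomorphic_on ball 0 1" using f by (auto simp: typically_real_def)
  have "((\<lambda>t. f (of_real r * cis (2*pi*t)) * cis (real n * (2*pi*t)) -
              f (of_real r * cis (2*pi*t)) * cis (- (real n * (2*pi*t)))) has_integral
          0 - of_real r ^ n * of_real (tcoeff f n)) {0..1}"
    unfolding typically_real_coeff[OF f]
    by (intro has_integral_diff holomorphic_circle_integral_cis_neg
        holomorphic_circle_integral_cis_pos hol r n)
  from has_integral_linear[OF this bounded_linear_Re]
  have "((\<lambda>t. -2 * (Im (f (of_real r * cis (2*pi*t))) * sin (real n * (2*pi*t)))) has_integral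
          - (r ^ n * tcoeff f n)) {0..1}"
    by (simp add: o_def algebra_simps flip: of_real_power of_real_mult)
  from has_integral_mult_right[OF this, of "-1/2"] show ?thesis
    by simp
qed

lemma typically_real_circle_sign:
  assumes f: "f \<in> typically_real" and r: "0 < r" "r < 1"
  shows "Im (f (of_real r * cis \<theta>)) * sin \<theta> \<ge> 0"
proof -
  have "of_real r * cis \<theta> \<in> ball 0 1" using r by (simp add: norm_mult)
  then have "Im (of_real r * cis \<theta>) * Im (f (of_real r * cis \<theta>)) \<ge> 0"
    using f unfolding typically_real_def by blast
  then have "r * (Im (f (of_real r * cis \<theta>)) * sin \<theta>) \<ge> 0"
    by (simp add: mult_ac)
  then show ?thesis using r by (simp add: zero_le_mult_iff)
qed

section \<open>Inequalities between the second and third coefficients\<close>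

lemma sin_treble: "sin (3 * x) = sin x * (4 * (cos x)\<^sup>2 - 1)" for x :: real
proof -
  have "sin (3 * x) = sin (2 * x + x)" by simp
  also have "\<dots> = sin x * (4 * (cos x)\<^sup>2 - 1)"
    unfolding sin_add sin_double cos_double_cos by (simp add: power2_eq_square algebra_simps)
  finally show ?thesis .
qed

text \<open>The right-hand side is twice the integral of Im f against sin theta (x + y cos theta)^2.
  Keeping \<open>x\<close> and \<open>y\<close> free gives a positive semidefinite quadratic
  form.\<close>

lemma typically_real_quadratic_form_circle:
  assumes f: "f \<in> typically_real" and r: "0 < r" "r < 1"
  shows "0 \<le> x\<^sup>2 * r + x * y * (r ^ 2 * tcoeff f 2) + y\<^sup>2 / 4 * (r + r ^ 3 * tcoeff f 3)"
proof -
  have a1: "tcoeff f 1 = 1" using typically_real_expansion(3)[OF f, of 0] by simp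
  let ?F = "\<lambda>t. Im (f (of_real r * cis (2*pi*t)))"
  note S = typically_real_sine_coefficient[OF f r]
  have I: "((\<lambda>t. (x\<^sup>2 + y\<^sup>2/4) * (?F t * sin (real 1 * (2*pi*t))) + x * y * (?F t * sin (real 2 * (2*pi*t)))
        + y\<^sup>2/4 * (?F t * sin (real 3 * (2*pi*t)))) has_integral
      (x\<^sup>2 + y\<^sup>2/4) * (r ^ 1 * tcoeff f 1 / 2) + x * y * (r ^ 2 * tcoeff f 2 / 2)
        + y\<^sup>2/4 * (r ^ 3 * tcoeff f 3 / 2)) {0..1}"
    by (intro has_integral_add has_integral_mult_right S) auto
  \<comment> \<open>The square is expanded with 2 sin cos = sin(2 theta) and 4 sin cos^2 = sin theta
    + sin(3 theta).\<close>
  have eq: "(x\<^sup>2 + y\<^sup>2/4) * (u * sin (real 1 * \<theta>)) + x * y * (u * sin (real 2 * \<theta>))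
        + y\<^sup>2/4 * (u * sin (real 3 * \<theta>)) = u * sin \<theta> * (x + y * cos \<theta>)\<^sup>2" for u \<theta> :: real
    unfolding of_nat_1 of_nat_numeral sin_double sin_treble
    by (simp add: power2_eq_square algebra_simps)
  have "0 \<le> (x\<^sup>2 + y\<^sup>2/4) * (r ^ 1 * tcoeff f 1 / 2) + x * y * (r ^ 2 * tcoeff f 2 / 2)
        + y\<^sup>2/4 * (r ^ 3 * tcoeff f 3 / 2)"
    by (rule has_integral_nonneg[OF I], unfold eq)
      (intro mult_nonneg_nonneg typically_real_circle_sign[OF f r] zero_le_power2)
  then show ?thesis using a1 by (simp add: algebra_simps)
qed

text \<open>The weight is 4 sin^3 theta = 3 sin theta - sin(3 theta), that is, sin theta times a
  square.\<close>

lemma typically_real_a3_circle: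
  assumes f: "f \<in> typically_real" and r: "0 < r" "r < 1"
  shows "r ^ 3 * tcoeff f 3 \<le> 3 * r"
proof -
  have a1: "tcoeff f 1 = 1" using typically_real_expansion(3)[OF f, of 0] by simp
  let ?F = "\<lambda>t. Im (f (of_real r * cis (2*pi*t)))"
  note S = typically_real_sine_coefficient[OF f r]
  have I: "((\<lambda>t. 3 * (?F t * sin (real 1 * (2*pi*t))) - ?F t * sin (real 3 * (2*pi*t))) has_integral
      3 * (r ^ 1 * tcoeff f 1 / 2) - r ^ 3 * tcoeff f 3 / 2) {0..1}"
    by (intro has_integral_diff has_integral_mult_right S) auto
  have eq: "3 * (u * sin (real 1 * \<theta>)) - u * sin (real 3 * \<theta>) = u * sin \<theta> * (2 * sin \<theta>)\<^sup>2"
    for u \<theta> :: real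
  proof -
    have s3: "sin (3 * \<theta>) = sin \<theta> * (3 - 4 * (sin \<theta>)\<^sup>2)"
      by (simp add: sin_treble cos_squared_eq)
    show ?thesis unfolding of_nat_1 of_nat_numeral s3
      by (simp add: power2_eq_square algebra_simps)
  qed
  have "0 \<le> 3 * (r ^ 1 * tcoeff f 1 / 2) - r ^ 3 * tcoeff f 3 / 2"
    by (rule has_integral_nonneg[OF I], unfold eq)
      (intro mult_nonneg_nonneg typically_real_circle_sign[OF f r] zero_le_power2)
  then show ?thesis using a1 by simp
qed

lemma nonneg_at_1_if_nonneg_on_01:
  fixes p :: "real \<Rightarrow> real"
  assumes p: "continuous_on UNIV p" and nonneg: "\<And>r. 0 < r \<Longrightarrow> r < 1 \<Longrightarrow> 0 \<le> p r"
  shows "0 \<le> p 1"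
proof (rule tendsto_lowerbound)
  show "(p \<longlongrightarrow> p 1) (at_left 1)"
    using p by (auto simp: continuous_on_def intro: tendsto_within_subset)
  show "\<forall>\<^sub>F r in at_left 1. 0 \<le> p r"
    using eventually_at_left_real[of 0 1] by (auto elim!: eventually_mono intro: nonneg)
qed simp

lemma typically_real_a3_le:
  assumes f: "f \<in> typically_real"
  shows "tcoeff f 3 \<le> 3"
proof -
  have "0 \<le> 3 * 1 - 1 ^ 3 * tcoeff f 3"
    by (rule nonneg_at_1_if_nonneg_on_01[of "\<lambda>r. 3 * r - r ^ 3 * tcoeff f 3"])
      (auto intro!: continuous_intros typically_real_a3_circle[OF f])
  then show ?thesis by simp
qed

lemma typically_real_a2_square_le:
  assumes f: "f \<in> typically_real"
  shows "(tcoeff f 2)\<^sup>2 \<le> 1 + tcoeff f 3"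
proof -
  let ?q = "\<lambda>x y r. x\<^sup>2 * r + x * y * (r ^ 2 * tcoeff f 2) + y\<^sup>2 / 4 * (r + r ^ 3 * tcoeff f 3)"
  have "0 \<le> ?q x y 1" for x y
    by (rule nonneg_at_1_if_nonneg_on_01[of "?q x y"])
      (intro continuous_intros typically_real_quadratic_form_circle[OF f]; simp)+
  \<comment> \<open>At r = 1 and y = -2 the form is x^2 - 2 x a2 + 1 + a3, which is smallest at x =
    a2.\<close>
  from this[of "tcoeff f 2" "-2"] show ?thesis
    by (simp add: power2_eq_square)
qed

section \<open>Bounds for the determinant\<close>

lemma T31_factorization:
  "T31 f = (1 - tcoeff f 3) * (1 + tcoeff f 3 - 2 * (tcoeff f 2)\<^sup>2)"
  by (simp add: T31_def Let_def det_3 power2_eq_square algebra_simps)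

lemma T31_abs_le:
  assumes f: "f \<in> typically_real"
  shows "\<bar>T31 f\<bar> \<le> 8"
proof -
  let ?s = "tcoeff f 3" and ?p = "(tcoeff f 2)\<^sup>2"
  have s: "?s \<le> 3" and p: "?p \<le> 1 + ?s" "0 \<le> ?p"
    using typically_real_a3_le[OF f] typically_real_a2_square_le[OF f] by auto
  have "\<bar>T31 f\<bar> = \<bar>1 - ?s\<bar> * \<bar>1 + ?s - 2 * ?p\<bar>"
    by (simp add: T31_factorization abs_mult)
  also have "\<dots> \<le> 2 * 4"
  proof (rule mult_mono)
    \<comment> \<open>From 0 <= p <= 1 + s and s <= 3 it follows that s lies in [-1, 3] and |1 + s -
      2 p| <= 1 + s <= 4.\<close>
    show "\<bar>1 - ?s\<bar> \<le> 2" "\<bar>1 + ?s - 2 * ?p\<bar> \<le> 4" using s p by linarith+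
  qed auto
  finally show ?thesis by simp
qed

section \<open>Extremal functions\<close>

lemma has_fps_expansion_of_sums_on_disc:
  fixes f :: "complex \<Rightarrow> complex"
  assumes "\<And>z. norm z < 1 \<Longrightarrow> (\<lambda>n. of_real (a n) * z ^ n) sums f z"
  shows "f has_fps_expansion Abs_fps (\<lambda>n. of_real (a n))"
  by (rule has_fps_expansionI)
    (use assms in \<open>auto simp: eventually_nhds intro!: exI[of _ "ball 0 1"]\<close>)

lemma tcoeff_eq_of_sums:
  assumes "\<And>z. norm z < 1 \<Longrightarrow> (\<lambda>n. of_real (a n) * z ^ n) sums f z"
  shows "tcoeff f n = a n"
  using fps_nth_fps_expansion[OF has_fps_expansion_of_sums_on_disc[OF assms], of n]
  by (metis Re_complex_of_real fps_nth_Abs_fps tcoeff_def)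

lemma typically_realI_sums:
  assumes sums: "\<And>z. norm z < 1 \<Longrightarrow> (\<lambda>n. of_real (a n) * z ^ n) sums f z"
    and a: "a 0 = 0" "a 1 = 1"
    and sign: "\<And>z. norm z < 1 \<Longrightarrow> Im z * Im (f z) \<ge> 0"
  shows "f \<in> typically_real"
proof -
  have "f holomorphic_on ball 0 1"
    by (rule power_series_holomorphic[of 0 1 "\<lambda>n. of_real (a n)"]) (use sums in auto)
  moreover have "(deriv ^^ n) f 0 / fact n = of_real (a n)" for n
    using fps_nth_fps_expansion[OF has_fps_expansion_of_sums_on_disc[OF sums], of n] by simp
  from this[of 0] this[of 1] have "f 0 = 0" "deriv f 0 = 1" using a by auto
  ultimately show ?thesis using sign by (simp add: typically_real_def)
qed

definition koebe :: "complex \<Rightarrow> complex" where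
  "koebe z = z / (1 - z)\<^sup>2"

lemma koebe_sums:
  assumes "norm z < 1"
  shows "(\<lambda>n. of_real (real n) * z ^ n) sums koebe z"
proof -
  have "(\<lambda>n. z * (of_nat (Suc n) * z ^ n)) sums (z * (1 / (1 - z)\<^sup>2))"
    by (intro sums_mult geometric_deriv_sums assms)
  then have "(\<lambda>n. of_real (real (Suc n)) * z ^ Suc n) sums koebe z"
    by (simp add: koebe_def algebra_simps)
  then show ?thesis by (subst (asm) sums_Suc_iff) simp
qed

text \<open>Multiplying numerator and denominator by the conjugate of (1 - z)^2 gives the numerator
  z - 2 |z|^2 + |z|^2 cnj z, whose imaginary part is Im z (1 - |z|^2).\<close>

lemma Im_koebe_sign:
  assumes z: "norm z < 1"
  shows "Im z * Im (koebe z) \<ge> 0"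
proof -
  have "Im (koebe z) = Im (z * cnj ((1 - z)\<^sup>2)) / (norm ((1 - z)\<^sup>2))\<^sup>2"
    unfolding koebe_def by (subst complex_div_cnj) (simp flip: of_real_power)
  also have "Im (z * cnj ((1 - z)\<^sup>2)) = Im z * (1 - (norm z)\<^sup>2)"
    unfolding cmod_power2 by (simp add: power2_eq_square algebra_simps)
  finally have "Im z * Im (koebe z) = (Im z)\<^sup>2 * (1 - (norm z)\<^sup>2) / (norm ((1 - z)\<^sup>2))\<^sup>2"
    by (simp add: power2_eq_square)
  moreover have "(norm z)\<^sup>2 \<le> 1" using z by (simp add: power_le_one)
  ultimately show ?thesis by simp
qed

definition koebe_odd :: "complex \<Rightarrow> complex" where
  "koebe_odd z = (koebe z - koebe (- z)) / 2"

lemma koebe_odd_sums: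
  assumes "norm z < 1"
  shows "(\<lambda>n. of_real (if odd n then real n else 0) * z ^ n) sums koebe_odd z"
proof -
  have "(\<lambda>n. (of_real (real n) * z ^ n - of_real (real n) * (- z) ^ n) / 2) sums koebe_odd z"
    unfolding koebe_odd_def using assms by (intro sums_divide sums_diff koebe_sums) auto
  also have "(\<lambda>n. (of_real (real n) * z ^ n - of_real (real n) * (- z) ^ n) / 2) =
      (\<lambda>n. of_real (if odd n then real n else 0) * z ^ n)"
    by (auto simp: fun_eq_iff)
  finally show ?thesis .
qed

text \<open>The sign condition for \<open>koebe\<close> at -z is the one for -koebe(-z) at z, and it
  passes to averages.\<close>

lemma Im_koebe_odd_sign:
  assumes "norm z < 1"
  shows "Im z * Im (koebe_odd z) \<ge> 0"
  using Im_koebe_sign[of z] Im_koebe_sign[of "- z"] assms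
  by (simp add: koebe_odd_def algebra_simps)

theorem theorem2p10:
  shows "((\<exists>f\<in>typically_real. T31 f = 8) \<and> (\<forall>f\<in>typically_real. T31 f \<le> 8)) \<and>
         ((\<exists>f\<in>typically_real. T31 f = -8) \<and> (\<forall>f\<in>typically_real. T31 f \<ge> -8))"
proof -
  have "koebe \<in> typically_real"
    by (rule typically_realI_sums[OF koebe_sums]) (use Im_koebe_sign in auto)
  \<comment> \<open>Here a2 = 2 and a3 = 3, so the factors are -2 and -4; for
    \<open>koebe_odd\<close>, a2 = 0 and a3 = 3 give -2 and 4.\<close>
  moreover have "T31 koebe = 8"
    by (simp add: T31_factorization tcoeff_eq_of_sums[OF koebe_sums])
  moreover have "koebe_odd \<in> typically_real"
    by (rule typically_realI_sums[OF koebe_odd_sums]) (use Im_koebe_odd_sign in auto)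
  moreover have "T31 koebe_odd = -8"
    by (simp add: T31_factorization tcoeff_eq_of_sums[OF koebe_odd_sums])
  ultimately show ?thesis
    using T31_abs_le by (auto simp: abs_le_iff) force+
qed

end
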